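(* Let $B$ be a Blaschke product with weak Property $\mathfrak{H}$. Then $\lim_{\eta\to0}\delta_{B,\eta}=0$.
   Context: $\mathbb{D}$ is the open unit disk. An inner function is a bounded analytic function on $\mathbb{D}$ with unimodular radial limits almost everywhere on $\partial\mathbb{D}$. A Blaschke product is an inner function $B(z)=\lambda z^m\prod_n\frac{|\alpha_n|}{\alpha_n}\frac{\alpha_n-z}{1-\overline{\alpha_n}z}$ with $|\lambda|=1$, $m\ge0$ an integer, $\{\alpha_n\}$ a finite or infinite sequence in $\mathbb{D}\setminus\{0\}$ with $\sum_n(1-|\alpha_n|)<\infty$. For an inner function $u$ and $\theta\in(0,1)$ put $\Omega_{u,\theta}=\{z\in\mathbb{D}:|u(z)|<\theta\}$. Let $\rho(z_1,z_2)=\left|\frac{z_1-z_2}{1-\overline{z_1}z_2}\right|$ and, for $\eta\in(0,1)$, $\delta_{u,\eta}=\sup\{\rho(z_1,z_2): z_1,z_2 \text{ belong to the same connected component of }\Omega_{u,\eta}\}$ (supremum in $[0,1]$). Weak Property $\mathfrak{B}$: there is $\theta\in(0,1)$ such that the closure of each component of $\Omega_{u,\theta}$ is contained in $\mathbb{D}$. Weak Property $\mathfrak{H}$: $u$ has weak Property $\mathfrak{B}$ and there exists $\eta\in(0,1)$ with $\delta_{u,\eta}<1$. *)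

theory Defs
  imports "HOL-Complex_Analysis.Complex_Analysis"
begin

text \<open>
  Functions on the open unit disk are total functions \<open>complex \<Rightarrow> complex\<close>; every notion below
  depends only on their values on \<open>ball 0 1\<close>.
\<close>

definition inner_function :: "(complex \<Rightarrow> complex) \<Rightarrow> bool" where
  "inner_function u \<longleftrightarrow>
     u holomorphic_on ball 0 1 \<and>
     bounded (u ` ball 0 1) \<and>
     (AE t in lebesgue_on {0..2*pi}.
        \<exists>L. ((\<lambda>r. u (of_real r * cis t)) \<longlongrightarrow> L) (at_left 1) \<and> cmod L = 1)"

text \<open>
  The zero sequence is \<open>\<alpha> 0, \<alpha> 1, \<dots>\<close> with \<open>N\<close> terms, where \<open>N = \<infinity>\<close> gives an infinite sequence;
  values \<open>\<alpha> n\<close> with \<open>n \<ge> N\<close> are ignored (they contribute the factor \<open>1\<close> to the product).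
\<close>

definition blaschke_product :: "(complex \<Rightarrow> complex) \<Rightarrow> bool" where
  "blaschke_product B \<longleftrightarrow>
     inner_function B \<and>
     (\<exists>c m (N :: enat) \<alpha>.
        cmod c = 1 \<and>
        (\<forall>n. enat n < N \<longrightarrow> \<alpha> n \<in> ball 0 1 - {0}) \<and>
        summable (\<lambda>n. if enat n < N then 1 - cmod (\<alpha> n) else 0) \<and>
        (\<forall>z\<in>ball 0 1.
           B z = c * z ^ m *
             (\<Prod>n. if enat n < N
                  then of_real (cmod (\<alpha> n)) / \<alpha> n * ((\<alpha> n - z) / (1 - cnj (\<alpha> n) * z))
                  else 1)))"

definition sublevel :: "(complex \<Rightarrow> complex) \<Rightarrow> real \<Rightarrow> complex set" where
  "sublevel u \<theta> = {z \<in> ball 0 1. cmod (u z) < \<theta>}"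

definition pseudohyp_dist :: "complex \<Rightarrow> complex \<Rightarrow> real" where
  "pseudohyp_dist z w = cmod ((z - w) / (1 - cnj z * w))"

text \<open>
  The supremum is taken in \<open>[0,1]\<close>, so it is \<open>0\<close> when the sublevel set is empty. Inserting \<open>0\<close>
  realises this for the real-valued \<open>Sup\<close>, whose value on the empty set is otherwise not \<open>0\<close> by
  definition; it changes nothing for a nonempty sublevel set, where \<open>z1 = z2\<close> already yields \<open>0\<close>.
\<close>

definition component_diam :: "(complex \<Rightarrow> complex) \<Rightarrow> real \<Rightarrow> real" where
  "component_diam u \<eta> =
     Sup (insert 0 {pseudohyp_dist z1 z2 | z1 z2.
                      \<exists>C\<in>components (sublevel u \<eta>). z1 \<in> C \<and> z2 \<in> C})"

definition weak_property_B :: "(complex \<Rightarrow> complex) \<Rightarrow> bool" where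
  "weak_property_B u \<longleftrightarrow>
     (\<exists>\<theta>\<in>{0<..<1}. \<forall>C\<in>components (sublevel u \<theta>). closure C \<subseteq> ball 0 1)"

definition weak_property_H :: "(complex \<Rightarrow> complex) \<Rightarrow> bool" where
  "weak_property_H u \<longleftrightarrow>
     weak_property_B u \<and> (\<exists>\<eta>\<in>{0<..<1}. component_diam u \<eta> < 1)"

end

theory Submission imports Defs
begin

text \<open>
  Let \<open>\<eta>\<^sub>1\<close> be small enough that every component \<open>C\<close> of \<open>sublevel B \<eta>\<^sub>1\<close> is relatively compact in
  the disk and has pseudohyperbolic diameter at most \<open>\<delta> < 1\<close>. Divide \<open>B\<close> by the disk automorphisms
  vanishing at its zeros in \<open>C\<close>; by the Schwarz lemma the quotient \<open>g\<close> obeys the same bound \<open>M\<close>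
  as \<open>B\<close>. At a frontier point of \<open>C\<close>, where \<open>\<bar>B\<bar> = \<eta>\<^sub>1\<close>, this gives \<open>\<eta>\<^sub>1 \<le> M \<delta>\<^sup>n\<close>, so the number \<open>n\<close>
  of zeros is bounded by some \<open>N\<close> independent of \<open>C\<close>. The minimum principle gives \<open>\<bar>g\<bar> \<ge> \<eta>\<^sub>1\<close> on \<open>C\<close>,
  so that where \<open>\<bar>B\<bar> < \<eta>\<^sub>1 \<epsilon>\<^sup>N\<close> one of the factors is smaller than \<open>\<epsilon>\<close>. Hence each component of
  \<open>sublevel B \<eta>\<close> with \<open>\<eta> < \<eta>\<^sub>1 \<epsilon>\<^sup>N\<close> is covered by \<open>N\<close> pseudohyperbolic disks of radius \<open>\<epsilon>\<close>, and by
  connectedness its diameter is \<open>O(N \<epsilon>)\<close>.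
\<close>

section \<open>Pseudohyperbolic distance and the Schwarz lemma\<close>

lemma pseudohyp_dist_eq_Moebius: "pseudohyp_dist z w = cmod (Moebius_function 0 z w)"
  by (simp add: pseudohyp_dist_def Moebius_function_simple norm_divide norm_minus_commute)

lemma pseudohyp_dist_nonneg: "0 \<le> pseudohyp_dist z w"
  by (simp add: pseudohyp_dist_def)

lemma pseudohyp_dist_self: "pseudohyp_dist z z = 0"
  by (simp add: pseudohyp_dist_def)

lemma pseudohyp_dist_less_1:
  assumes "z \<in> ball 0 1" "w \<in> ball 0 1"
  shows "pseudohyp_dist z w < 1"
  using assms by (simp add: pseudohyp_dist_eq_Moebius Moebius_function_norm_lt_1)

lemma continuous_on_pseudohyp_dist:
  assumes "z \<in> ball 0 1"
  shows "continuous_on (ball 0 1) (pseudohyp_dist z)"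
  unfolding pseudohyp_dist_eq_Moebius [abs_def]
  using assms
  by (intro continuous_on_norm holomorphic_on_imp_continuous_on Moebius_function_holomorphic) simp

text \<open>Moving \<open>a\<close> to 0 by a disk automorphism reduces this to the Schwarz lemma
  for functions bounded by \<open>M\<close>. Keeping the same bound \<open>M\<close> for the
  quotient is what allows the division to be repeated.\<close>

lemma bounded_holomorphic_divide_zero:
  assumes holf: "f holomorphic_on ball 0 1"
    and le: "\<And>z. z \<in> ball 0 1 \<Longrightarrow> cmod (f z) \<le> M"
    and a: "a \<in> ball 0 1" and fa: "f a = 0"
  obtains g where "g holomorphic_on ball 0 1"
    and "\<And>z. z \<in> ball 0 1 \<Longrightarrow> cmod (g z) \<le> M"
    and "\<And>z. z \<in> ball 0 1 \<Longrightarrow> f z = Moebius_function 0 a z * g z"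
proof -
  let ?\<phi> = "Moebius_function 0 a" and ?\<psi> = "Moebius_function 0 (-a)"
  have in_ball: "?\<phi> z \<in> ball 0 1" "?\<psi> z \<in> ball 0 1" if "z \<in> ball 0 1" for z
    using that a by (simp_all add: Moebius_function_norm_lt_1)
  have hol: "?\<phi> holomorphic_on ball 0 1" "?\<psi> holomorphic_on ball 0 1"
    using a by (simp_all add: Moebius_function_holomorphic)
  have holF: "(f \<circ> ?\<psi>) holomorphic_on ball 0 1"
    using in_ball by (intro holomorphic_on_compose_gen [OF hol(2) holf]) auto
  have F0: "(f \<circ> ?\<psi>) 0 = 0"
    by (simp add: Moebius_function_of_zero fa)
  obtain h where holh: "h holomorphic_on ball 0 1"
    and h: "\<And>z. cmod z < 1 \<Longrightarrow> (f \<circ> ?\<psi>) z = z * h z" and h0: "deriv (f \<circ> ?\<psi>) 0 = h 0"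
    using Schwarz3 [OF holF F0] by blast
  have M0: "0 \<le> M"
    using le [OF a] fa by simp
  \<comment> \<open>The Schwarz lemma needs a strict bound and a nonzero divisor, so
    \<open>f\<close> is scaled by an arbitrary \<open>K\<close> above \<open>M\<close>, which may be
    0. Letting \<open>K\<close> decrease to \<open>M\<close> gives the claim.\<close>
  have h_less: "cmod (h z) \<le> K" if z: "cmod z < 1" and K: "M < K" for z K
  proof -
    have K0: "0 < K"
      using M0 K by simp
    let ?G = "\<lambda>z. (f \<circ> ?\<psi>) z / of_real K"
    have holG: "?G holomorphic_on ball 0 1"
      using K0 by (intro holomorphic_intros holF) simp
    have G0: "?G 0 = 0"
      using F0 by simp
    have less: "cmod (?G z) < 1" if "cmod z < 1" for z
    proof -
      have "cmod (f (?\<psi> z)) < K"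
        using le [OF in_ball(2), of z] that K by simp
      then show ?thesis
        using K0 by (simp add: norm_divide)
    qed
    show ?thesis
    proof (cases "z = 0")
      case True
      \<comment> \<open>At 0 the quotient is the derivative, so the derivative part of the Schwarz
        lemma takes over.\<close>
      have "(f \<circ> ?\<psi>) field_differentiable at 0"
        using holF by (intro holomorphic_on_imp_differentiable_at) auto
      then have "deriv ?G 0 = h 0 / of_real K"
        using h0 by (metis deriv_cdivide_right)
      moreover have "cmod (deriv ?G 0) \<le> 1"
        using Schwarz_Lemma(2) [OF holG G0 less z] .
      ultimately show ?thesis
        using True K0 by (simp add: norm_divide)
    next
      case False
      have "cmod (?G z) \<le> cmod z"
        using Schwarz_Lemma(1) [OF holG G0 less z] .
      then show ?thesis
        using False K0 h [OF z] by (simp add: norm_divide norm_mult divide_le_eq mult.commute)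
    qed
  qed
  show ?thesis
  proof
    show "(h \<circ> ?\<phi>) holomorphic_on ball 0 1"
      using in_ball by (intro holomorphic_on_compose_gen [OF hol(1) holh]) auto
    show "cmod ((h \<circ> ?\<phi>) z) \<le> M" if "z \<in> ball 0 1" for z
      using in_ball(1) [OF that] by (auto intro: dense_ge h_less)
    show "f z = ?\<phi> z * (h \<circ> ?\<phi>) z" if "z \<in> ball 0 1" for z
    proof -
      have "?\<psi> (?\<phi> z) = z"
        using that a by (intro Moebius_function_compose) auto
      then show ?thesis
        using h [of "?\<phi> z"] in_ball(1) [OF that] by simp
    qed
  qed
qed

text \<open>A weak triangle inequality, which avoids the algebra needed for the sharp one.\<close>

lemma pseudohyp_dist_lipschitz:
  assumes "z \<in> ball 0 1" "x \<in> ball 0 1" "a \<in> ball 0 1"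
  shows "\<bar>pseudohyp_dist z x - pseudohyp_dist z a\<bar> \<le> 2 * pseudohyp_dist a x"
proof -
  let ?f = "Moebius_function 0 z"
  have less: "cmod (?f y) < 1" if "y \<in> ball 0 1" for y
    using that assms by (simp add: Moebius_function_norm_lt_1)
  \<comment> \<open>This difference vanishes at \<open>a\<close> and is bounded by 2 on the disk, so
    the division lemma applies; hence the factor 2.\<close>
  have hol: "(\<lambda>y. ?f y - ?f a) holomorphic_on ball 0 1"
    using assms by (intro holomorphic_intros Moebius_function_holomorphic) auto
  have le: "cmod (?f y - ?f a) \<le> 2" if "y \<in> ball 0 1" for y
    using norm_triangle_ineq4 [of "?f y" "?f a"] less [OF that] less [OF assms(3)] by simp
  obtain g where "\<And>y. y \<in> ball 0 1 \<Longrightarrow> cmod (g y) \<le> 2"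
    "\<And>y. y \<in> ball 0 1 \<Longrightarrow> ?f y - ?f a = Moebius_function 0 a y * g y"
    by (rule bounded_holomorphic_divide_zero [OF hol le assms(3)]) (assumption, simp, blast)
  then have "cmod (g x) \<le> 2" "?f x - ?f a = Moebius_function 0 a x * g x"
    using assms(2) by blast+
  then have "cmod (?f x - ?f a) \<le> 2 * pseudohyp_dist a x"
    by (simp add: norm_mult pseudohyp_dist_eq_Moebius mult.commute mult_right_mono)
  then show ?thesis
    using norm_triangle_ineq3 [of "?f x" "?f a"] by (simp add: pseudohyp_dist_eq_Moebius)
qed

text \<open>On a connected set the distance from \<open>z\<close> takes every value in
  \<open>{0..L}\<close>. Of \<open>N + 1\<close> equally spaced values two are attained near the
  same centre, so the spacing \<open>L / N\<close> is below \<open>4 * \<epsilon>\<close>.\<close>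

lemma pseudohyp_dist_le_of_connected_cover:
  assumes S: "connected S" "S \<subseteq> ball 0 1"
    and A: "finite A" "A \<subseteq> ball 0 1" "card A \<le> N"
    and cover: "\<And>x. x \<in> S \<Longrightarrow> \<exists>a\<in>A. pseudohyp_dist a x < \<epsilon>"
    and zw: "z \<in> S" "w \<in> S"
  shows "pseudohyp_dist z w \<le> 4 * real N * \<epsilon>"
proof -
  define L where "L = pseudohyp_dist z w"
  have "A \<noteq> {}"
    using cover zw by auto
  then have N: "0 < N"
    using A card_gt_0_iff by fastforce
  have L0: "0 \<le> L"
    by (simp add: L_def pseudohyp_dist_nonneg)
  have "connected (pseudohyp_dist z ` S)"
    using S zw by (intro connected_continuous_image
        continuous_on_subset [OF continuous_on_pseudohyp_dist]) auto
  moreover have "0 \<in> pseudohyp_dist z ` S" "L \<in> pseudohyp_dist z ` S"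
    using zw pseudohyp_dist_self [of z] by (force simp: L_def)+
  ultimately have Icc: "{0..L} \<subseteq> pseudohyp_dist z ` S"
    by (rule connected_contains_Icc)
  have "\<exists>x a. x \<in> S \<and> a \<in> A \<and> pseudohyp_dist a x < \<epsilon> \<and>
      pseudohyp_dist z x = real i * L / real N" if "i \<le> N" for i
  proof -
    have "real i * L / real N \<le> L"
      using that N L0 by (simp add: divide_le_eq mult.commute mult_left_mono)
    then have "real i * L / real N \<in> pseudohyp_dist z ` S"
      using Icc L0 by auto
    then obtain x where "x \<in> S" "pseudohyp_dist z x = real i * L / real N"
      by (metis imageE)
    then show ?thesis
      using cover by blast
  qed
  then obtain x a where xa: "\<And>i. i \<le> N \<Longrightarrow> x i \<in> S \<and> a i \<in> A \<and> pseudohyp_dist (a i) (x i) < \<epsilon> \<and>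
      pseudohyp_dist z (x i) = real i * L / real N"
    by metis
  have "card (a ` {..N}) \<le> card A"
    using xa A by (intro card_mono) auto
  \<comment> \<open>The \<open>N + 1\<close> indices share at most \<open>N\<close> centres.\<close>
  then have "\<not> inj_on a {..N}"
    using A by (intro pigeonhole) simp
  then obtain i j where ij: "i \<le> N" "j \<le> N" "i < j" "a i = a j"
    by (metis atMost_iff linorder_inj_onI')
  have near: "\<bar>real k * L / real N - pseudohyp_dist z (a k)\<bar> < 2 * \<epsilon>" if "k \<le> N" for k
    using pseudohyp_dist_lipschitz [of z "x k" "a k"] xa [OF that] S A zw by force
  have triangle: "t - s < 4 * \<epsilon>" if "\<bar>s - p\<bar> < 2 * \<epsilon>" "\<bar>t - p\<bar> < 2 * \<epsilon>" for s t p
    using that by linarith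
  have "real j * L / real N - real i * L / real N < 4 * \<epsilon>"
    using triangle [OF near [OF ij(1), unfolded ij(4)] near [OF ij(2)]] .
  moreover have "L / real N \<le> real j * L / real N - real i * L / real N"
  proof -
    have "1 * (L / real N) \<le> (real j - real i) * (L / real N)"
      using ij L0 by (intro mult_right_mono) auto
    then show ?thesis
      by (simp add: left_diff_distrib diff_divide_distrib)
  qed
  ultimately have "L / real N \<le> 4 * \<epsilon>"
    by linarith
  then show ?thesis
    using N by (simp add: L_def divide_le_eq mult_ac)
qed

section \<open>Products over lists of zeros\<close>

lemma prod_list_le_power:
  fixes f :: "'a \<Rightarrow> real"
  assumes "\<And>x. x \<in> set xs \<Longrightarrow> 0 \<le> f x" "\<And>x. x \<in> set xs \<Longrightarrow> f x \<le> d"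
  shows "0 \<le> (\<Prod>x\<leftarrow>xs. f x) \<and> (\<Prod>x\<leftarrow>xs. f x) \<le> d ^ length xs"
  using assms
proof (induction xs)
  case (Cons x xs)
  then have "0 \<le> f x" "f x \<le> d"
    "0 \<le> (\<Prod>x\<leftarrow>xs. f x)" "(\<Prod>x\<leftarrow>xs. f x) \<le> d ^ length xs"
    by simp_all
  then show ?case
    by (simp add: mult_mono)
qed simp

lemma power_le_prod_list:
  fixes f :: "'a \<Rightarrow> real"
  assumes "0 \<le> d" "\<And>x. x \<in> set xs \<Longrightarrow> d \<le> f x"
  shows "d ^ length xs \<le> (\<Prod>x\<leftarrow>xs. f x)"
  using assms(2)
proof (induction xs)
  case (Cons x xs)
  then have "d \<le> f x" "d ^ length xs \<le> (\<Prod>x\<leftarrow>xs. f x)"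
    by simp_all
  then show ?case
    using assms(1) by (simp add: mult_mono)
qed simp

lemma cmod_prod_list_Moebius:
  "cmod (\<Prod>a\<leftarrow>as. Moebius_function 0 a z) = (\<Prod>a\<leftarrow>as. pseudohyp_dist a z)"
  by (induction as) (simp_all add: norm_mult pseudohyp_dist_eq_Moebius)

section \<open>Components of sublevel sets and the zeros inside them\<close>

lemma open_sublevel:
  assumes "continuous_on (ball 0 1) u"
  shows "open (sublevel u \<theta>)"
proof -
  have "sublevel u \<theta> = ball 0 1 \<inter> (\<lambda>z. cmod (u z)) -` {..<\<theta>}"
    by (auto simp: sublevel_def)
  then show ?thesis
    using assms by (simp add: continuous_open_preimage continuous_on_norm)
qed

text \<open>A frontier point of larger modulus has a neighbourhood missing \<open>C\<close>. One of
  smaller modulus lies in some open component, which must meet \<open>C\<close> and hence equal it,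
  although the open set \<open>C\<close> omits its frontier.\<close>

lemma cmod_eq_on_frontier_sublevel_component:
  assumes cont: "continuous_on (ball 0 1) u"
    and C: "C \<in> components (sublevel u \<theta>)"
    and w: "w \<in> frontier C" "w \<in> ball 0 1"
  shows "cmod (u w) = \<theta>"
proof (rule antisym)
  have opn: "open (sublevel u \<theta>)"
    by (rule open_sublevel [OF cont])
  have "open C"
    using open_components [OF opn C] .
  then have wC: "w \<notin> C" "w \<in> closure C"
    using w by (auto simp: frontier_def interior_open)
  have Csub: "C \<subseteq> sublevel u \<theta>"
    using C by (rule in_components_subset)
  show "cmod (u w) \<le> \<theta>"
  proof (rule ccontr)
    let ?V = "ball 0 1 \<inter> (\<lambda>z. cmod (u z)) -` {\<theta><..}"
    assume "\<not> cmod (u w) \<le> \<theta>"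
    then have "w \<in> ?V"
      using w by simp
    moreover have "open ?V"
      using cont by (intro continuous_open_preimage continuous_on_norm) auto
    ultimately obtain y where "y \<in> ?V" "y \<in> C"
      using wC(2) open_Int_closure_eq_empty [of ?V C] by blast
    then show False
      using Csub by (auto simp: sublevel_def)
  qed
  show "\<theta> \<le> cmod (u w)"
  proof (rule ccontr)
    assume "\<not> \<theta> \<le> cmod (u w)"
    then have "w \<in> sublevel u \<theta>"
      using w by (simp add: sublevel_def)
    then obtain D where D: "D \<in> components (sublevel u \<theta>)" "w \<in> D"
      using Union_components by blast
    have "open D"
      using open_components [OF opn D(1)] .
    then have "C \<inter> D \<noteq> {}"
      using D(2) wC(2) open_Int_closure_eq_empty [of D C] by blast
    then have "C = D"
      using C D components_eq by blast
    then show False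
      using wC D by simp
  qed
qed

text \<open>
  The zeros are split off one at a time; this stops before \<open>N\<close> steps because of \<open>M * \<delta> ^ N < \<theta>\<close>,
  so no separate argument for the finiteness of the zero set or about multiplicities is needed.
\<close>

lemma divide_zeros_in_component:
  assumes holu: "u holomorphic_on ball 0 1"
    and le: "\<And>z. z \<in> ball 0 1 \<Longrightarrow> cmod (u z) \<le> M"
    and C: "C \<in> components (sublevel u \<theta>)" and cl: "closure C \<subseteq> ball 0 1"
    and diam: "\<And>z w. z \<in> C \<Longrightarrow> w \<in> C \<Longrightarrow> pseudohyp_dist z w \<le> \<delta>"
    and \<delta>: "\<delta> \<le> 1" and N: "M * \<delta> ^ N < \<theta>"
  obtains as g where "set as \<subseteq> C" "length as \<le> N"
    and "g holomorphic_on ball 0 1"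
    and "\<And>z. z \<in> ball 0 1 \<Longrightarrow> u z = (\<Prod>a\<leftarrow>as. Moebius_function 0 a z) * g z"
    and "\<And>z. z \<in> C \<Longrightarrow> g z \<noteq> 0"
proof -
  have cont: "continuous_on (ball 0 1) u"
    using holu by (rule holomorphic_on_imp_continuous_on)
  have Cball: "C \<subseteq> ball 0 1"
    using cl closure_subset by blast
  have "C \<noteq> {}"
    using C by (rule in_components_nonempty)
  moreover have "C \<noteq> UNIV"
    using Cball not_bounded_UNIV bounded_subset bounded_ball by metis
  ultimately obtain w where w: "w \<in> frontier C"
    using frontier_eq_empty by blast
  then have wcl: "w \<in> closure C" and wball: "w \<in> ball 0 1"
    using cl by (auto simp: frontier_def)
  have uw: "cmod (u w) = \<theta>"
    using cmod_eq_on_frontier_sublevel_component [OF cont C w wball] .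
  \<comment> \<open>The diameter bound passes from \<open>C\<close> to its frontier point
    \<open>w\<close> by continuity.\<close>
  have dist_w: "pseudohyp_dist a w \<le> \<delta>" if "a \<in> C" for a
  proof (rule continuous_le_on_closure [OF _ wcl])
    show "continuous_on (closure C) (pseudohyp_dist a)"
      using that cl Cball
      by (intro continuous_on_subset [OF continuous_on_pseudohyp_dist]) auto
  qed (use that diam in blast)
  obtain z0 where "z0 \<in> C"
    using \<open>C \<noteq> {}\<close> by blast
  then have \<delta>0: "0 \<le> \<delta>"
    using diam [of z0 z0] pseudohyp_dist_nonneg order_trans by blast
  have M0: "0 \<le> M"
    using le [OF wball] norm_ge_zero order_trans by blast
  \<comment> \<open>\<open>P n\<close> says that \<open>n\<close> zeros in \<open>C\<close>,
    repeated according to multiplicity in the list, can be split off with a cofactor still bounded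
    by \<open>M\<close>.\<close>
  define P where "P n \<longleftrightarrow> (\<exists>as g. length as = n \<and> set as \<subseteq> C \<and> g holomorphic_on ball 0 1 \<and>
    (\<forall>z\<in>ball 0 1. cmod (g z) \<le> M) \<and>
    (\<forall>z\<in>ball 0 1. u z = (\<Prod>a\<leftarrow>as. Moebius_function 0 a z) * g z))" for n
  have "P 0"
    using holu le by (auto simp: P_def)
  \<comment> \<open>Evaluation at \<open>w\<close> gives
    \<open>\<theta> \<le> M * \<delta> ^ n\<close>, which the choice of \<open>N\<close> excludes
    once \<open>n > N\<close>.\<close>
  have bound: "n \<le> N" if Pn: "P n" for n
  proof (rule ccontr)
    assume "\<not> n \<le> N"
    obtain as g where as: "length as = n" "set as \<subseteq> C" and g: "cmod (g w) \<le> M"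
      and eq: "u w = (\<Prod>a\<leftarrow>as. Moebius_function 0 a w) * g w"
      using Pn wball unfolding P_def by blast
    have "\<theta> = (\<Prod>a\<leftarrow>as. pseudohyp_dist a w) * cmod (g w)"
      using uw eq by (simp add: norm_mult cmod_prod_list_Moebius)
    also have "\<dots> \<le> \<delta> ^ n * M"
      using prod_list_le_power [of as "\<lambda>a. pseudohyp_dist a w" \<delta>] as g dist_w \<delta>0
      by (intro mult_mono) (auto simp: pseudohyp_dist_nonneg)
    also have "\<dots> \<le> \<delta> ^ N * M"
      using \<open>\<not> n \<le> N\<close> \<delta> \<delta>0 M0 by (intro mult_right_mono power_decreasing) auto
    finally show False
      using N by (simp add: mult.commute)
  qed
  define n where "n = Greatest P"
  have "P n"
    using GreatestI_nat [of P, OF \<open>P 0\<close> bound] by (simp add: n_def)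
  have max: "k \<le> n" if "P k" for k
    using Greatest_le_nat [of P, OF that bound] by (simp add: n_def)
  obtain as g where as: "length as = n" "set as \<subseteq> C" and holg: "g holomorphic_on ball 0 1"
    and g: "\<And>z. z \<in> ball 0 1 \<Longrightarrow> cmod (g z) \<le> M"
    and eq: "\<And>z. z \<in> ball 0 1 \<Longrightarrow> u z = (\<Prod>a\<leftarrow>as. Moebius_function 0 a z) * g z"
    using \<open>P n\<close> unfolding P_def by blast
  \<comment> \<open>Another zero in \<open>C\<close> could be split off as well, contradicting the
    maximality of \<open>n\<close>.\<close>
  have "g z \<noteq> 0" if z: "z \<in> C" for z
  proof
    assume "g z = 0"
    moreover have "z \<in> ball 0 1"
      using z Cball by blast
    ultimately obtain h where h: "h holomorphic_on ball 0 1"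
      "\<And>y. y \<in> ball 0 1 \<Longrightarrow> cmod (h y) \<le> M"
      "\<And>y. y \<in> ball 0 1 \<Longrightarrow> g y = Moebius_function 0 z y * h y"
      using bounded_holomorphic_divide_zero [OF holg g] by metis
    have "P (Suc n)"
      unfolding P_def
      using as z h eq by (intro exI [of _ "z # as"] exI [of _ h]) (simp add: mult_ac)
    then show False
      using max by fastforce
  qed
  then show ?thesis
    using that [of as g] as bound [OF \<open>P n\<close>] holg eq by blast
qed

text \<open>The centres are the zeros in \<open>C\<close>. The zero-free cofactor \<open>g\<close>
  has modulus at least \<open>\<theta>\<close> on \<open>C\<close>, so a small value of
  \<open>u\<close> forces a small Moebius factor. One set \<open>A\<close> serves every
  \<open>\<epsilon>\<close>.\<close>

lemma sublevel_component_covered: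
  assumes holu: "u holomorphic_on ball 0 1"
    and le: "\<And>z. z \<in> ball 0 1 \<Longrightarrow> cmod (u z) \<le> M"
    and C: "C \<in> components (sublevel u \<theta>)" and cl: "closure C \<subseteq> ball 0 1"
    and diam: "\<And>z w. z \<in> C \<Longrightarrow> w \<in> C \<Longrightarrow> pseudohyp_dist z w \<le> \<delta>"
    and \<delta>: "\<delta> \<le> 1" and N: "M * \<delta> ^ N < \<theta>" and \<theta>: "0 < \<theta>"
  obtains A where "finite A" "A \<subseteq> C" "card A \<le> N"
    and "\<And>z \<epsilon>. \<lbrakk>z \<in> C; 0 \<le> \<epsilon>; \<epsilon> \<le> 1; cmod (u z) < \<theta> * \<epsilon> ^ N\<rbrakk> \<Longrightarrow> \<exists>a\<in>A. pseudohyp_dist a z < \<epsilon>"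
proof -
  obtain as g where as: "set as \<subseteq> C" "length as \<le> N"
    and holg: "g holomorphic_on ball 0 1"
    and eq: "\<And>z. z \<in> ball 0 1 \<Longrightarrow> u z = (\<Prod>a\<leftarrow>as. Moebius_function 0 a z) * g z"
    and g0: "\<And>z. z \<in> C \<Longrightarrow> g z \<noteq> 0"
    using divide_zeros_in_component [OF holu le C cl diam \<delta> N] by blast
  have cont: "continuous_on (ball 0 1) u"
    using holu by (rule holomorphic_on_imp_continuous_on)
  have Cball: "C \<subseteq> ball 0 1"
    using cl closure_subset by blast
  have norm_u: "cmod (u z) = (\<Prod>a\<leftarrow>as. pseudohyp_dist a z) * cmod (g z)" if "z \<in> ball 0 1" for z
    using eq [OF that] by (simp add: norm_mult cmod_prod_list_Moebius)
  \<comment> \<open>On the frontier \<open>u\<close> has modulus \<open>\<theta>\<close>, and the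
    Moebius factors removed from it have modulus at most 1.\<close>
  have g_frontier: "\<theta> \<le> cmod (g z)" if z: "z \<in> frontier C" for z
  proof -
    have zball: "z \<in> ball 0 1"
      using z cl by (auto simp: frontier_def)
    have "(\<Prod>a\<leftarrow>as. pseudohyp_dist a z) \<le> 1 ^ length as"
      using prod_list_le_power [of as "\<lambda>a. pseudohyp_dist a z" 1]
        pseudohyp_dist_less_1 [OF _ zball] as Cball
      by (force simp: pseudohyp_dist_nonneg less_imp_le)
    then have "(\<Prod>a\<leftarrow>as. pseudohyp_dist a z) * cmod (g z) \<le> 1 * cmod (g z)"
      by (intro mult_right_mono) simp_all
    then show ?thesis
      using norm_u [OF zball] cmod_eq_on_frontier_sublevel_component [OF cont C z zball] by simp
  qed
  have gnz: "g z \<noteq> 0" if "z \<in> closure C" for z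
    using that g0 g_frontier \<theta> closure_Un_frontier [of C] by fastforce
  have g_ge: "\<theta> \<le> cmod (g z)" if z: "z \<in> C" for z
  proof -
    \<comment> \<open>The minimum principle for \<open>g\<close>, as the maximum principle for its
      reciprocal.\<close>
    have "cmod (inverse (g z)) \<le> inverse \<theta>"
    proof (rule maximum_modulus_frontier [where S = C and f = "\<lambda>z. inverse (g z)"])
      show "(\<lambda>z. inverse (g z)) holomorphic_on interior C"
        using holg g0 Cball interior_subset
        by (intro holomorphic_on_inverse holomorphic_on_subset [OF holg]) blast+
      show "continuous_on (closure C) (\<lambda>z. inverse (g z))"
        using gnz cl by (intro continuous_on_inverse
            continuous_on_subset [OF holomorphic_on_imp_continuous_on [OF holg]]) auto
      show "bounded C"
        using Cball bounded_ball bounded_subset by blast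
      show "cmod (inverse (g z)) \<le> inverse \<theta>" if "z \<in> frontier C" for z
        using g_frontier [OF that] \<theta> by (simp add: norm_inverse le_imp_inverse_le)
    qed (rule z)
    then show ?thesis
      using \<theta> g0 [OF z] by (simp add: norm_inverse)
  qed
  show ?thesis
  proof
    show "card (set as) \<le> N"
      using card_length as(2) order_trans by blast
    fix z \<epsilon> assume z: "z \<in> C" and \<epsilon>: "0 \<le> \<epsilon>" "\<epsilon> \<le> 1" "cmod (u z) < \<theta> * \<epsilon> ^ N"
    show "\<exists>a\<in>set as. pseudohyp_dist a z < \<epsilon>"
    proof (rule ccontr)
      assume "\<not> (\<exists>a\<in>set as. pseudohyp_dist a z < \<epsilon>)"
      then have "\<epsilon> ^ length as \<le> (\<Prod>a\<leftarrow>as. pseudohyp_dist a z)"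
        using \<epsilon> by (intro power_le_prod_list) (auto simp: not_less)
      moreover have "\<epsilon> ^ N \<le> \<epsilon> ^ length as"
        using \<epsilon> as by (intro power_decreasing) auto
      moreover have "0 \<le> \<epsilon> ^ N"
        using \<epsilon> by simp
      ultimately have "\<epsilon> ^ N * \<theta> \<le> (\<Prod>a\<leftarrow>as. pseudohyp_dist a z) * cmod (g z)"
        using g_ge [OF z] \<theta> by (intro mult_mono) linarith+
      then show False
        using \<epsilon> norm_u [of z] z Cball by (auto simp: mult.commute)
    qed
  qed (use as in auto)
qed

section \<open>Comparison of levels and bounds for \<open>component_diam\<close>\<close>

lemma sublevel_mono: "\<theta> \<le> \<eta> \<Longrightarrow> sublevel u \<theta> \<subseteq> sublevel u \<eta>"
  by (auto simp: sublevel_def)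

lemma component_of_smaller_sublevel:
  assumes "C \<in> components (sublevel u \<theta>)" "\<theta> \<le> \<eta>"
  obtains D where "D \<in> components (sublevel u \<eta>)" "C \<subseteq> D"
proof -
  have "C \<subseteq> sublevel u \<eta>"
    using in_components_subset [OF assms(1)] sublevel_mono [OF assms(2)] by blast
  moreover have "sublevel u \<eta> \<noteq> {}"
    using calculation in_components_nonempty [OF assms(1)] by blast
  ultimately show ?thesis
    using exists_component_superset [of C] in_components_connected [OF assms(1)] that by blast
qed

lemma bdd_above_component_diam:
  "bdd_above (insert 0 {pseudohyp_dist z1 z2 | z1 z2.
     \<exists>C\<in>components (sublevel u \<eta>). z1 \<in> C \<and> z2 \<in> C})"
proof (rule bdd_aboveI [of _ 1])
  have "pseudohyp_dist z1 z2 \<le> 1"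
    if "C \<in> components (sublevel u \<eta>)" "z1 \<in> C" "z2 \<in> C" for C z1 z2
    using in_components_subset [OF that(1)] that
    by (intro less_imp_le pseudohyp_dist_less_1) (auto simp: sublevel_def)
  then show "x \<le> 1" if "x \<in> insert 0 {pseudohyp_dist z1 z2 | z1 z2.
     \<exists>C\<in>components (sublevel u \<eta>). z1 \<in> C \<and> z2 \<in> C}" for x
    using that by auto
qed

lemma component_diam_upper:
  assumes "C \<in> components (sublevel u \<eta>)" "z \<in> C" "w \<in> C"
  shows "pseudohyp_dist z w \<le> component_diam u \<eta>"
  unfolding component_diam_def using assms
  by (intro cSup_upper bdd_above_component_diam) blast

lemma component_diam_nonneg: "0 \<le> component_diam u \<eta>"
  unfolding component_diam_def by (intro cSup_upper bdd_above_component_diam) blast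

lemma component_diam_least:
  assumes "0 \<le> d"
    and "\<And>C z w. \<lbrakk>C \<in> components (sublevel u \<eta>); z \<in> C; w \<in> C\<rbrakk> \<Longrightarrow> pseudohyp_dist z w \<le> d"
  shows "component_diam u \<eta> \<le> d"
  unfolding component_diam_def using assms by (intro cSup_least) auto

theorem lemma4p6:
  fixes B :: "complex \<Rightarrow> complex"
  assumes "blaschke_product B"
    and "weak_property_H B"
  shows "(component_diam B \<longlongrightarrow> 0) (at_right 0)"
proof -
  have hol: "B holomorphic_on ball 0 1" and "bounded (B ` ball 0 1)"
    using assms(1) by (auto simp: blaschke_product_def inner_function_def)
  then obtain M where M: "0 < M" "\<And>z. z \<in> ball 0 1 \<Longrightarrow> cmod (B z) \<le> M"
    unfolding bounded_pos by auto
  obtain \<theta> \<eta>\<^sub>0 where \<theta>: "0 < \<theta>" "\<And>C. C \<in> components (sublevel B \<theta>) \<Longrightarrow> closure C \<subseteq> ball 0 1"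
    and \<eta>\<^sub>0: "0 < \<eta>\<^sub>0" "component_diam B \<eta>\<^sub>0 < 1"
    using assms(2) unfolding weak_property_H_def weak_property_B_def by auto
  \<comment> \<open>Components at this level lie inside components at both \<open>\<theta>\<close>
    and \<open>\<eta>\<^sub>0\<close>, inheriting relative compactness from the former and the
    diameter bound from the latter.\<close>
  define \<eta>\<^sub>1 where "\<eta>\<^sub>1 = min \<theta> \<eta>\<^sub>0"
  define \<delta> where "\<delta> = component_diam B \<eta>\<^sub>0"
  have \<eta>\<^sub>1: "0 < \<eta>\<^sub>1" "\<eta>\<^sub>1 \<le> \<theta>" "\<eta>\<^sub>1 \<le> \<eta>\<^sub>0"
    using \<theta> \<eta>\<^sub>0 by (auto simp: \<eta>\<^sub>1_def)
  have \<delta>: "0 \<le> \<delta>" "\<delta> < 1"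
    using \<eta>\<^sub>0 component_diam_nonneg by (auto simp: \<delta>_def)
  \<comment> \<open>\<open>N\<close> depends only on \<open>M\<close>, \<open>\<delta>\<close> and
    \<open>\<eta>\<^sub>1\<close>, so it is uniform over all components and fixed before
    \<open>\<epsilon>\<close> is chosen.\<close>
  obtain N where "\<delta> ^ N < \<eta>\<^sub>1 / M"
    using real_arch_pow_inv [of "\<eta>\<^sub>1 / M" \<delta>] \<eta>\<^sub>1 M \<delta> by auto
  then have N: "M * \<delta> ^ N < \<eta>\<^sub>1"
    using M by (simp add: field_simps)
  have cl: "closure C \<subseteq> ball 0 1" if C: "C \<in> components (sublevel B \<eta>\<^sub>1)" for C
  proof -
    obtain D where "D \<in> components (sublevel B \<theta>)" "C \<subseteq> D"
      using component_of_smaller_sublevel [OF C \<eta>\<^sub>1(2)] .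
    then show ?thesis
      using \<theta>(2) closure_mono by blast
  qed
  have diam: "pseudohyp_dist z w \<le> \<delta>"
    if C: "C \<in> components (sublevel B \<eta>\<^sub>1)" and zw: "z \<in> C" "w \<in> C" for C z w
  proof -
    obtain D where D: "D \<in> components (sublevel B \<eta>\<^sub>0)" "C \<subseteq> D"
      using component_of_smaller_sublevel [OF C \<eta>\<^sub>1(3)] .
    then show ?thesis
      unfolding \<delta>_def using zw D(2) by (intro component_diam_upper [OF D(1)]) auto
  qed
  have small: "component_diam B \<eta> \<le> 4 * real N * \<epsilon>"
    if \<epsilon>: "0 < \<epsilon>" "\<epsilon> \<le> 1" and \<eta>: "\<eta> \<le> \<eta>\<^sub>1 * \<epsilon> ^ N" for \<eta> \<epsilon>
  proof (rule component_diam_least)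
    fix D z w assume D: "D \<in> components (sublevel B \<eta>)" and zw: "z \<in> D" "w \<in> D"
    have "\<eta>\<^sub>1 * \<epsilon> ^ N \<le> \<eta>\<^sub>1 * 1"
      using \<epsilon> \<eta>\<^sub>1 by (intro mult_left_mono power_le_one) auto
    then have "\<eta> \<le> \<eta>\<^sub>1"
      using \<eta> by simp
    then obtain C where C: "C \<in> components (sublevel B \<eta>\<^sub>1)" "D \<subseteq> C"
      using component_of_smaller_sublevel [OF D] by blast
    obtain A where A: "finite A" "A \<subseteq> C" "card A \<le> N"
      and cover: "\<And>z \<epsilon>. \<lbrakk>z \<in> C; 0 \<le> \<epsilon>; \<epsilon> \<le> 1; cmod (B z) < \<eta>\<^sub>1 * \<epsilon> ^ N\<rbrakk>
        \<Longrightarrow> \<exists>a\<in>A. pseudohyp_dist a z < \<epsilon>"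
      using sublevel_component_covered
        [OF hol M(2) C(1) cl [OF C(1)] diam [OF C(1)] less_imp_le [OF \<delta>(2)] N \<eta>\<^sub>1(1)] by blast
    have Cball: "C \<subseteq> ball 0 1"
      using cl [OF C(1)] closure_subset by blast
    show "pseudohyp_dist z w \<le> 4 * real N * \<epsilon>"
    proof (rule pseudohyp_dist_le_of_connected_cover [OF _ _ A(1) _ A(3) _ zw])
      show "connected D"
        using D by (rule in_components_connected)
      show "\<exists>a\<in>A. pseudohyp_dist a x < \<epsilon>" if "x \<in> D" for x
        using that C(2) in_components_subset [OF D] \<epsilon> \<eta>
        by (intro cover) (auto simp: sublevel_def)
    qed (use A C Cball in auto)
  qed (use \<epsilon> in simp)
  show ?thesis
  proof (rule tendstoI)
    fix e :: real assume e: "0 < e"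
    \<comment> \<open>The summand 1 keeps the denominator positive when \<open>N = 0\<close> and
      makes the final inequality strict.\<close>
    define \<epsilon> where "\<epsilon> = min 1 (e / (4 * real N + 1))"
    have \<epsilon>: "0 < \<epsilon>" "\<epsilon> \<le> 1"
      using e by (auto simp: \<epsilon>_def)
    have "(4 * real N + 1) * \<epsilon> \<le> (4 * real N + 1) * (e / (4 * real N + 1))"
      by (intro mult_left_mono) (auto simp: \<epsilon>_def)
    also have "\<dots> = e"
      by (simp add: add_nonneg_eq_0_iff)
    finally have less: "4 * real N * \<epsilon> < e"
      using \<epsilon> by (simp add: distrib_right)
    have "0 < \<eta>\<^sub>1 * \<epsilon> ^ N"
      using \<eta>\<^sub>1 \<epsilon> by simp
    then have "\<forall>\<^sub>F \<eta> in at_right 0. \<eta> < \<eta>\<^sub>1 * \<epsilon> ^ N"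
      by (rule order_tendstoD(2) [OF tendsto_ident_at])
    then show "\<forall>\<^sub>F \<eta> in at_right 0. dist (component_diam B \<eta>) 0 < e"
    proof eventually_elim
      case (elim \<eta>)
      then show ?case
        using small [OF \<epsilon>, of \<eta>] less component_diam_nonneg [of B \<eta>] by (simp add: dist_real_def)
    qed
  qed
qed

end
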